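(* Let $R$ be a commutative Noetherian ring and let $A=\bigoplus_{e\ge 0}A_e$ be a degree-wise finitely generated (not necessarily commutative) $\mathbb{N}$-graded ring with $A_0=R$ which is a left skew $R$-algebra. Let $\{c_e(A)\}_{e\ge 0}$ be its complexity sequence, and assume that its generating function $\mathcal{G}_A(T)=\sum_{e\ge 0}c_e(A)T^e$ is a rational function of $T$. Then the complexity of $A$ is $$\operatorname{cx}(A)=\frac{1}{|\lambda|},$$ where $\lambda\in\mathbb{C}$ is a pole of $\mathcal{G}_A(T)$ of minimal absolute value.
   Context: Let $A=\bigoplus_{e\ge 0}A_e$ be an $\mathbb{N}$-graded ring (not necessarily commutative) with $A_0=R$. It is called a left skew $R$-algebra if $aR\subseteq Ra$ for all homogeneous $a\in A$. Complexity sequence: set $G_{-1}(A)=A_0$, and for $e\ge 0$ let $G_e(A)$ be the subring of $A$ generated by the elements of degree $\le e$. Let $(G_{e-1}(A))_e$ denote the degree $e$ component of $G_{e-1}(A)$. Then $c_e(A)$ is the (minimal) number of homogeneous generators of $A_e/(G_{e-1}(A))_e$ over $A_0$ (as a left $A_0$-module). The sequence $\{c_e(A)\}_{e\ge 0}$ is the complexity sequence of $A$. The ring $A$ is assumed degree-wise finitely generated, which ensures $c_e(A)<+\infty$ for all $e$. Complexity: $\operatorname{cx}(A):=\inf\{\mu\in\mathbb{R}_{>0} \mid c_e(A)=O(\mu^e) \text{ as } e\to\infty\}$, and $\operatorname{cx}(A)=\infty$ if there is no such $\mu$. The generating function of $A$ is the power series $\mathcal{G}_A(T)=\sum_{e\ge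 0}c_e(A)T^e$. Saying that it is a rational function means that it is the power series expansion at $0$ of a quotient of two polynomials in $T$; its poles are the poles in $\mathbb{C}$ of this rational function. *)

theory Defs
  imports "HOL-Complex_Analysis.Complex_Analysis" "HOL-Algebra.Generated_Rings" "HOL-Algebra.QuotRing" "HOL-Algebra.Module" "HOL-Algebra.Ring_Divisibility"
begin

text \<open>The ring need not be commutative; \<open>gr e\<close> is the additive group $A_e$.\<close>

locale graded_ring = ring A for A (structure) +
  fixes gr :: "nat \<Rightarrow> 'a set"
  assumes gr_additive_subgroup: "additive_subgroup (gr e) A"
    and gr_one: "\<one> \<in> gr 0"
    and gr_mult: "\<lbrakk>a \<in> gr i; b \<in> gr j\<rbrakk> \<Longrightarrow> a \<otimes> b \<in> gr (i + j)"
    and gr_direct_sum: "a \<in> carrier A \<Longrightarrow>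
      \<exists>!f. (\<forall>e. f e \<in> gr e) \<and> finite {e. f e \<noteq> \<zero>} \<and> a = (\<Oplus>e\<in>{e. f e \<noteq> \<zero>}. f e)"

definition homogeneous :: "(nat \<Rightarrow> 'a set) \<Rightarrow> 'a set" where
  "homogeneous gr = (\<Union>e. gr e)"

definition degree_zero_ring :: "('a, 'm) ring_scheme \<Rightarrow> (nat \<Rightarrow> 'a set) \<Rightarrow> ('a, 'm) ring_scheme" where
  "degree_zero_ring A gr = A\<lparr>carrier := gr 0\<rparr>"

definition left_skew_algebra ::
  "('a, 'n) ring_scheme \<Rightarrow> ('a, 'm) ring_scheme \<Rightarrow> (nat \<Rightarrow> 'a set) \<Rightarrow> bool" where
  "left_skew_algebra R A gr \<longleftrightarrow>
     (\<forall>a\<in>homogeneous gr. a <#\<^bsub>A\<^esub> carrier R \<subseteq> carrier R #>\<^bsub>A\<^esub> a)"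

text \<open>The subrings $G_k(A)$ for $k \ge -1$, with $G_{-1}(A) = A_0$.\<close>

definition G_subring :: "('a, 'm) ring_scheme \<Rightarrow> (nat \<Rightarrow> 'a set) \<Rightarrow> int \<Rightarrow> 'a set" where
  "G_subring A gr k =
     (if k < 0 then gr 0 else generate_ring A (\<Union>i\<in>{i. int i \<le> k}. gr i))"

text \<open>Degree-wise finite generation: every $G_e(A)$ is generated, as a ring over $A_0$, by
  finitely many homogeneous elements. For a left skew algebra with $A_0 = R$ this is equivalent
  to every $A_e$ being a finitely generated left $A_0$-module.\<close>

definition degreewise_fin_gen :: "('a, 'm) ring_scheme \<Rightarrow> (nat \<Rightarrow> 'a set) \<Rightarrow> bool" where
  "degreewise_fin_gen A gr \<longleftrightarrow>
     (\<forall>e. \<exists>S. finite S \<and> S \<subseteq> homogeneous gr \<and>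
        G_subring A gr (int e) = generate_ring A (gr 0 \<union> S))"

text \<open>The fields \<open>mult\<close> and \<open>one\<close> of a module record play no role.\<close>

definition component_module ::
  "('a, 'm) ring_scheme \<Rightarrow> (nat \<Rightarrow> 'a set) \<Rightarrow> nat \<Rightarrow> ('a, 'a) module" where
  "component_module A gr e =
     \<lparr>carrier = gr e, monoid.mult = monoid.mult A, one = \<one>\<^bsub>A\<^esub>,
      ring.zero = \<zero>\<^bsub>A\<^esub>, ring.add = ring.add A, module.smult = monoid.mult A\<rparr>"

definition quotient_module :: "('r, 'a, 'm) module_scheme \<Rightarrow> 'a set \<Rightarrow> ('r, 'a set) module" where
  "quotient_module M N =
     \<lparr>carrier = a_rcosets\<^bsub>M\<^esub> N, monoid.mult = undefined, one = undefined,
      ring.zero = N, ring.add = set_add M,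
      module.smult = (\<lambda>r X. \<Union>x\<in>X. N +>\<^bsub>M\<^esub> (r \<odot>\<^bsub>M\<^esub> x))\<rparr>"

definition generates_module ::
  "('r, 'n) ring_scheme \<Rightarrow> ('r, 'b, 'm) module_scheme \<Rightarrow> 'b set \<Rightarrow> bool" where
  "generates_module R M S \<longleftrightarrow>
     S \<subseteq> carrier M \<and> \<Inter>{N. submodule N R M \<and> S \<subseteq> N} = carrier M"

text \<open>Meaningful for finitely generated modules only.\<close>

definition min_num_generators ::
  "('r, 'n) ring_scheme \<Rightarrow> ('r, 'b, 'm) module_scheme \<Rightarrow> nat" where
  "min_num_generators R M = (LEAST n. \<exists>S. finite S \<and> card S = n \<and> generates_module R M S)"

text \<open>All elements of $A_e / (G_{e-1}(A))_e$ are homogeneous of degree $e$, so homogeneity of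
  the generators is automatic. The module is finitely generated when \<open>A\<close> is left skew and
  degree-wise finitely generated.\<close>

definition complexity_seq :: "('a, 'm) ring_scheme \<Rightarrow> (nat \<Rightarrow> 'a set) \<Rightarrow> nat \<Rightarrow> nat" where
  "complexity_seq A gr e =
     min_num_generators (degree_zero_ring A gr)
       (quotient_module (component_module A gr e) (G_subring A gr (int e - 1) \<inter> gr e))"

text \<open>The infimum is taken in the extended reals, where that of the empty set is \<open>\<infinity>\<close>.\<close>

definition complexity :: "('a, 'm) ring_scheme \<Rightarrow> (nat \<Rightarrow> 'a set) \<Rightarrow> ereal" where
  "complexity A gr =
     (INF \<mu>\<in>{\<mu>::real. \<mu> > 0 \<and> (\<lambda>e. real (complexity_seq A gr e)) \<in> O(\<lambda>e. \<mu> ^ e)}. ereal \<mu>)"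

definition generating_function :: "('a, 'm) ring_scheme \<Rightarrow> (nat \<Rightarrow> 'a set) \<Rightarrow> complex fps" where
  "generating_function A gr = Abs_fps (\<lambda>e. of_nat (complexity_seq A gr e))"

end

theory Submission
  imports Defs
begin

text \<open>
  Near \<open>0\<close> the rational function agrees with the sum of its power series, so by the identity
  theorem it has no poles inside the disc of convergence, while it extends holomorphically to
  the largest disc around \<open>0\<close> that is free of poles. Hence the radius of convergence is $|\lambda|$.
  By comparison with geometric series, the complexity is the reciprocal of this radius.
\<close>

lemma fps_conv_radius_eq_norm_pole:
  fixes f :: "complex \<Rightarrow> complex"
  assumes mero: "f meromorphic_on UNIV"
    and F: "f has_fps_expansion F"
    and pole: "is_pole f w"
    and minimal: "\<And>z. is_pole f z \<Longrightarrow> norm w \<le> norm z"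
  shows "fps_conv_radius F = ereal (norm w)"
proof (rule antisym)
  have mero_at: "f meromorphic_on {z}" for z
    using mero by (rule meromorphic_on_subset) auto
  show "fps_conv_radius F \<le> ereal (norm w)"
  proof (rule ccontr)
    assume "\<not> ?thesis"
    hence w: "w \<in> eball 0 (fps_conv_radius F)"
      by (simp add: in_eball_iff not_le)
    define D where "D = eball (0::complex) (fps_conv_radius F)"
    have D: "open D" "connected D" "w \<in> D" "0 \<in> D"
      using w F by (auto simp: D_def in_eball_iff has_fps_expansion_def zero_ereal_def)
    have ana: "eval_fps F analytic_on D"
      by (rule FPS_Convergence.analytic_on_eval_fps) (simp add: D_def)
    have "(\<lambda>z. f z - eval_fps F z) meromorphic_on D"
      using meromorphic_on_subset[OF mero] analytic_on_imp_meromorphic_on[OF ana]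
      by (intro meromorphic_on_diff) auto
    \<comment> \<open>Identity theorem on the connected disc \<open>D\<close>: outside a sparse set
      the difference either vanishes or avoids 0. Avoiding 0 would contradict the agreement of
      \<open>f\<close> and its series near the origin.\<close>
    from meromorphic_imp_constant_or_avoid[OF this D(1,2), of 0]
    have "\<forall>\<^sub>F z in cosparse D. f z - eval_fps F z = 0"
    proof
      assume "\<forall>\<^sub>F z in cosparse D. f z - eval_fps F z \<noteq> 0"
      hence "\<forall>\<^sub>F z in at 0. f z - eval_fps F z \<noteq> 0"
        using D(4) by (rule eventually_cosparse_imp_eventually_at)
      moreover have "\<forall>\<^sub>F z in nhds 0. eval_fps F z = f z"
        using F by (simp add: has_fps_expansion_def)
      hence "\<forall>\<^sub>F z in at 0. eval_fps F z = f z"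
        by (simp add: eventually_at_filter eventually_mono)
      ultimately have "\<forall>\<^sub>F z in at (0::complex). False"
        by eventually_elim simp
      thus ?thesis by simp
    qed
    hence "\<forall>\<^sub>F z in at w. f z - eval_fps F z = 0"
      using D(3) by (rule eventually_cosparse_imp_eventually_at)
    hence "\<forall>\<^sub>F z in at w. f z = eval_fps F z"
      by simp
    \<comment> \<open>Being a pole depends only on a punctured neighbourhood, so the pole passes to
      the series, which is analytic at \<open>w\<close>.\<close>
    with pole have "is_pole (eval_fps F) w"
      by (auto intro: is_pole_transform)
    moreover have "eval_fps F analytic_on {w}"
      using ana by (rule analytic_on_subset) (use D in auto)
    ultimately show False
      using analytic_at_imp_no_pole by blast
  qed
  show "ereal (norm w) \<le> fps_conv_radius F"
  proof (rule holomorphic_on_imp_fps_conv_radius_ge)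
    \<comment> \<open>At a removable singularity \<open>f\<close> may take an arbitrary value, as
      \<open>p/q\<close> does at common zeros, where division by zero gives 0.
      \<open>remove_sings\<close> puts the limits there and changes nothing near 0.\<close>
    have "\<forall>\<^sub>F z in nhds 0. remove_sings f z = f z"
      using F by (intro eventually_remove_sings_eq_nhds has_fps_expansion_imp_analytic_0)
    thus "remove_sings f has_fps_expansion F"
      using F has_fps_expansion_cong by blast
    have "remove_sings f analytic_on {z}" if z: "norm z < norm w" for z
    proof -
      \<comment> \<open>A meromorphic function has no essential singularity, so where it has no pole
        it has a finite limit.\<close>
      from minimal[of z] z have "\<not> is_pole f z"
        by auto
      with meromorphic_on_not_essential[OF mero_at] obtain c where "f \<midarrow>z\<rightarrow> c"
        unfolding not_essential_def by blast
      thus ?thesis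
        by (intro remove_sings_analytic_at meromorphic_on_isolated_singularity mero_at)
    qed
    hence "remove_sings f analytic_on eball 0 (ereal (norm w))"
      by (subst analytic_on_analytic_at) (auto simp: in_eball_iff)
    thus "remove_sings f holomorphic_on eball 0 (ereal (norm w))"
      by (rule analytic_imp_holomorphic)
  qed
qed

text \<open>A growth form of the Cauchy-Hadamard formula: convergence at a point bounds the terms
  there, and a geometric bound gives convergence by comparison.\<close>

lemma INF_geometric_bounds_eq_inverse_conv_radius:
  fixes a :: "nat \<Rightarrow> 'a::{banach, real_normed_div_algebra}"
  assumes radius: "conv_radius a = ereal r" and "r > 0"
  shows "(INF \<mu>\<in>{\<mu>::real. \<mu> > 0 \<and> (\<lambda>n. norm (a n)) \<in> O(\<lambda>n. \<mu> ^ n)}. ereal \<mu>) = ereal (1 / r)"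
proof (rule antisym)
  have bound: "(\<lambda>n. norm (a n)) \<in> O(\<lambda>n. \<mu> ^ n)" if \<mu>: "1 / r < \<mu>" for \<mu>
  proof -
    have "\<mu> > 0"
      using \<mu> \<open>r > 0\<close> by (meson divide_pos_pos less_trans zero_less_one)
    \<comment> \<open>The point \<open>1 / \<mu>\<close> lies inside the disc of convergence, so the
      terms there tend to 0 and are eventually below 1, whence the constant 1 in the bound.\<close>
    hence "1 / \<mu> < r"
      using \<mu> \<open>r > 0\<close> by (simp add: field_simps)
    hence "summable (\<lambda>n. norm (a n * of_real (1 / \<mu>) ^ n))"
      using radius \<open>\<mu> > 0\<close> by (intro abs_summable_in_conv_radius) (simp del: of_real_divide)
    hence "(\<lambda>n. norm (a n * of_real (1 / \<mu>) ^ n)) \<longlonglongrightarrow> 0"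
      by (rule summable_LIMSEQ_zero)
    hence "\<forall>\<^sub>F n in sequentially. norm (a n * of_real (1 / \<mu>) ^ n) < 1"
      by (rule order_tendstoD) simp
    hence "\<forall>\<^sub>F n in sequentially. norm (norm (a n)) \<le> 1 * norm (\<mu> ^ n)"
      by eventually_elim (use \<open>\<mu> > 0\<close> in \<open>simp add: norm_mult norm_power field_simps del: of_real_divide\<close>)
    thus ?thesis
      by (rule bigoI)
  qed
  show "(INF \<mu>\<in>{\<mu>::real. \<mu> > 0 \<and> (\<lambda>n. norm (a n)) \<in> O(\<lambda>n. \<mu> ^ n)}. ereal \<mu>) \<le> ereal (1 / r)"
  \<comment> \<open>The infimum need not be attained: for \<open>a n = n\<close> the radius is 1,
    but \<open>a\<close> is not bounded. Hence the detour through \<open>1 / r + e\<close>.\<close>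
  proof (rule ereal_le_epsilon2)
    fix e :: real assume "e > 0"
    have "1 / r + e > 0"
      using \<open>r > 0\<close> \<open>e > 0\<close> by (simp add: add_pos_pos)
    with bound[of "1 / r + e"] \<open>e > 0\<close>
    show "(INF \<mu>\<in>{\<mu>::real. \<mu> > 0 \<and> (\<lambda>n. norm (a n)) \<in> O(\<lambda>n. \<mu> ^ n)}. ereal \<mu>)
        \<le> ereal (1 / r) + ereal e"
      by (intro INF_lower2[of "1 / r + e"]) auto
  qed
  show "ereal (1 / r) \<le> (INF \<mu>\<in>{\<mu>::real. \<mu> > 0 \<and> (\<lambda>n. norm (a n)) \<in> O(\<lambda>n. \<mu> ^ n)}. ereal \<mu>)"
  proof (rule INF_greatest)
    fix \<mu> assume "\<mu> \<in> {\<mu>::real. \<mu> > 0 \<and> (\<lambda>n. norm (a n)) \<in> O(\<lambda>n. \<mu> ^ n)}"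
    hence \<mu>: "\<mu> > 0" "(\<lambda>n. norm (a n)) \<in> O(\<lambda>n. \<mu> ^ n)"
      by auto
    \<comment> \<open>For \<open>0 < s < 1 / \<mu>\<close> the terms are dominated by a geometric
      series of ratio \<open>\<mu> * s < 1\<close>.\<close>
    have "conv_radius a \<ge> ereal (1 / \<mu>)"
    proof (rule conv_radius_geI_ex')
      fix s :: real assume s: "0 < s" "ereal s < ereal (1 / \<mu>)"
      have "(\<lambda>n. norm (a n) * s ^ n) \<in> O(\<lambda>n. \<mu> ^ n * s ^ n)"
        using \<mu>(2) by (intro landau_o.big.mult) auto
      moreover have "\<mu> * s < 1"
        using s \<mu>(1) by (simp add: field_simps)
      hence "summable (\<lambda>n. norm (\<mu> ^ n * s ^ n))"
        using s \<mu>(1) by (simp flip: power_mult_distrib)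
      ultimately have "summable (\<lambda>n. norm (a n) * s ^ n)"
        by (metis summable_comparison_test_bigo)
      hence "summable (\<lambda>n. norm (a n * of_real s ^ n))"
        using s by (simp add: norm_mult norm_power)
      thus "summable (\<lambda>n. a n * of_real s ^ n)"
        by (rule summable_norm_cancel)
    qed
    thus "ereal (1 / r) \<le> ereal \<mu>"
      using radius \<open>r > 0\<close> \<mu>(1) by (simp add: field_simps)
  qed
qed

text \<open>The fraction \<open>p/q\<close> may be unreduced: \<open>is_pole\<close> ignores zeros
  of \<open>q\<close> that cancel against \<open>p\<close>.\<close>

theorem theorem2p5:
  fixes R A :: "('a, 'm) ring_scheme" and gr :: "nat \<Rightarrow> 'a set"
    and p q :: "complex poly" and w :: complex
  assumes "cring R" and "noetherian_ring R"
    and "graded_ring A gr" and "R = degree_zero_ring A gr"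
    and "left_skew_algebra R A gr"
    and "degreewise_fin_gen A gr"
    and "q \<noteq> 0"
    and "(\<lambda>T. poly p T / poly q T) has_fps_expansion generating_function A gr"
    and "is_pole (\<lambda>T. poly p T / poly q T) w"
    and "\<And>z. is_pole (\<lambda>T. poly p T / poly q T) z \<Longrightarrow> norm w \<le> norm z"
  shows "complexity A gr = ereal (1 / norm w)"
proof -
  have "poly p' analytic_on UNIV" for p' :: "complex poly"
    by (auto simp: analytic_on_open holomorphic_on_def field_differentiable_def intro: poly_DERIV)
  hence "(\<lambda>T. poly p T / poly q T) meromorphic_on UNIV"
    by (intro meromorphic_intros analytic_on_imp_meromorphic_on)
  from fps_conv_radius_eq_norm_pole[OF this assms(8-10)]
  have radius: "fps_conv_radius (generating_function A gr) = ereal (norm w)" .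
  \<comment> \<open>\<open>has_fps_expansion\<close> includes a positive radius of convergence, so
    the pole is not at 0 and \<open>1 / norm w\<close> is a genuine reciprocal.\<close>
  hence "norm w > 0"
    using assms(8) by (auto simp: has_fps_expansion_def)
  from INF_geometric_bounds_eq_inverse_conv_radius[OF radius[unfolded fps_conv_radius_def] this]
  show ?thesis
    by (simp add: complexity_def generating_function_def)
qed

end
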